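(* Let $\theta\in[0,\pi/4]$ and $n\in\{1,2,3,\ldots\}$, and let $L_n(z,F_\theta)=\operatorname{tr}\big(S(z,F_\theta)^n\big)$ for $z\in\mathbb{C}\setminus\{0\}$. Then: (1) $L_n(z,F_\theta)$ is a Laurent polynomial of the form $$L_n(z,F_\theta)=z^n+z^{-n}+\sum_{-(n-1)\le k\le n-1}p_{k,n}(\theta)z^k,\qquad p_{k,n}(\theta)=p_{-k,n}(\theta).$$ (2) For $\theta\in(0,\pi/4)$ and every integer $k$ with $-(n-1)\le k\le n-1$: $p_{k,n}(\theta)=0$ if $k\not\equiv n\pmod 2$, and $p_{k,n}(\theta)>0$ if $k\equiv n\pmod 2$. (3) For $\theta\in[0,\pi/4)$, $$L_n(z,F_\theta)=2(\cos2\theta)^n\,T_n\!\left(\frac{z+z^{-1}}{2\cos2\theta}\right)\qquad\text{for all } z\in\mathbb{C}\setminus\{0\}.$$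
   Context: For $\theta\in[0,\pi/4]$, $F_\theta=\begin{bmatrix}\cos\theta&\sin\theta\\ \sin\theta&\cos\theta\end{bmatrix}$, and for $z\in\mathbb{C}\setminus\{0\}$ $$S(z,F_\theta)=F_\theta\begin{bmatrix}z&0\\0&z^{-1}\end{bmatrix}F_\theta.$$ $T_n$ is the Chebyshev polynomial of the first kind of degree $n$, $T_n(\zeta)=\cos(n\arccos\zeta)$ (as a polynomial, evaluated at any complex argument). *)

theory Defs
  imports
    "HOL-Analysis.Analysis"
    "HOL-Computational_Algebra.Computational_Algebra"
    "HOL-Number_Theory.Cong"
begin

definition F_mat :: "real \<Rightarrow> complex^2^2" where
  "F_mat \<theta> = vector [vector [of_real (cos \<theta>), of_real (sin \<theta>)],
                    vector [of_real (sin \<theta>), of_real (cos \<theta>)]]"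

definition S_mat :: "complex \<Rightarrow> complex^2^2 \<Rightarrow> complex^2^2" where
  "S_mat z F = F ** vector [vector [z, 0], vector [0, inverse z]] ** F"

(* The power operation (^) on 'a^'n^'n acts componentwise, so powers with respect
   to the matrix product are introduced separately. *)
definition mat_power :: "('a::semiring_1)^'n^'n \<Rightarrow> nat \<Rightarrow> 'a^'n^'n" where
  "mat_power A n = (((**) A) ^^ n) (mat 1)"

definition L_tr :: "nat \<Rightarrow> complex \<Rightarrow> complex^2^2 \<Rightarrow> complex" where
  "L_tr n z F = trace (mat_power (S_mat z F) n)"

(* Existence and uniqueness of this polynomial are proved in ex1_Chebyshev_T. *)
definition Chebyshev_T :: "nat \<Rightarrow> complex poly" where
  "Chebyshev_T n =
     (THE p. degree p = n \<and> (\<forall>\<zeta>. poly p \<zeta> = cos (of_nat n * Arccos \<zeta>)))"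

lemma ex_Chebyshev_T:
  "(\<exists>p::complex poly. degree p = n \<and> (\<forall>\<zeta>. poly p \<zeta> = cos (of_nat n * Arccos \<zeta>))) \<and>
   (\<exists>p::complex poly. degree p = Suc n \<and> (\<forall>\<zeta>. poly p \<zeta> = cos (of_nat (Suc n) * Arccos \<zeta>)))"
proof (induction n)
  case 0
  show ?case
    by (intro conjI exI[of _ "1::complex poly"] exI[of _ "[:0, 1::complex:]"]) auto
next
  case (Suc n)
  then obtain p q :: "complex poly" where
    p: "degree p = n" "\<And>\<zeta>. poly p \<zeta> = cos (of_nat n * Arccos \<zeta>)" and
    q: "degree q = Suc n" "\<And>\<zeta>. poly q \<zeta> = cos (of_nat (Suc n) * Arccos \<zeta>)"
    by blast
  define r where "r = [:0, 2:] * q - p"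
  have "q \<noteq> 0" using q(1) by auto
  then have dq: "degree ([:0, 2:] * q) = Suc (Suc n)"
    using q(1) by (subst degree_mult_eq) auto
  have "degree r = Suc (Suc n)"
    using dq p(1) degree_add_eq_left[of "- p" "[:0, 2:] * q"] unfolding r_def by simp
  moreover have "poly r \<zeta> = cos (of_nat (Suc (Suc n)) * Arccos \<zeta>)" for \<zeta>
  proof -
    define a where "a = Arccos \<zeta>"
    have "\<zeta> = cos a" by (simp add: a_def)
    moreover have "cos (of_nat (Suc n) * a + a) + cos (of_nat (Suc n) * a - a)
        = 2 * cos a * cos (of_nat (Suc n) * a)"
      by (simp only: cos_add cos_diff) (simp add: algebra_simps)
    moreover have "of_nat (Suc n) * a - a = of_nat n * a"
      and "of_nat (Suc n) * a + a = of_nat (Suc (Suc n)) * a"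
      by (simp_all add: algebra_simps)
    ultimately show ?thesis
      unfolding r_def poly_diff poly_mult p(2) q(2) a_def[symmetric]
      by (simp only: poly_pCons poly_0) (simp add: algebra_simps)
  qed
  ultimately show ?case using q by blast
qed

lemma ex1_Chebyshev_T:
  "\<exists>!p::complex poly. degree p = n \<and> (\<forall>\<zeta>. poly p \<zeta> = cos (of_nat n * Arccos \<zeta>))"
proof -
  have "\<exists>p::complex poly. degree p = n \<and> (\<forall>\<zeta>. poly p \<zeta> = cos (of_nat n * Arccos \<zeta>))"
    using ex_Chebyshev_T by blast
  then show ?thesis
    by (elim ex_ex1I) (auto intro!: poly_eq_poly_eq_iff[THEN iffD1])
qed

lemma degree_Chebyshev_T: "degree (Chebyshev_T n) = n"
  and poly_Chebyshev_T: "poly (Chebyshev_T n) \<zeta> = cos (of_nat n * Arccos \<zeta>)"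
  using theI'[OF ex1_Chebyshev_T[of n]] unfolding Chebyshev_T_def by blast+

end

theory Submission
  imports Defs
begin

text \<open>Moving the last factor of \<open>F D F\<close> to the front does not change the traces of the powers, so
  \<open>S(z, F\<^sub>\<theta>)\<close> may be replaced by \<open>D F\<^sub>\<theta>\<^sup>2\<close>, which has the rows \<open>(z, s z)\<close> and
  \<open>(s / z, 1 / z)\<close> with \<open>s = sin 2\<theta>\<close>. As \<open>s \<ge> 0\<close>, the Laurent coefficients of the entries of its
  powers are sums of nonnegative terms, which yields the positivity, and the symmetry in \<open>k\<close> comes
  from exchanging the two coordinates together with \<open>z\<close> and \<open>1 / z\<close>. The trace is \<open>z + 1 / z\<close> and
  the determinant is \<open>cos\<^sup>2 2\<theta>\<close>, so by Cayley--Hamilton the traces of the powers satisfy the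
  recurrence of the rescaled Chebyshev polynomials.\<close>

section \<open>Powers of matrices and their traces\<close>

lemma mat_power_0 [simp]: "mat_power A 0 = mat 1"
  and mat_power_Suc [simp]: "mat_power A (Suc n) = A ** mat_power A n"
  by (simp_all add: mat_power_def)

lemma mat_power_mult_Suc: "mat_power (A ** B) (Suc n) = A ** mat_power (B ** A) n ** B"
  by (induction n) (simp_all add: matrix_mul_assoc)

text \<open>Regrouping gives \<open>A ** mat_power (B ** A) m ** B\<close>; cyclicity of the trace
  then brings \<open>B\<close> to the front.\<close>

lemma trace_mat_power_mult_commute:
  fixes A B :: "'a::comm_semiring_1^'n^'n"
  shows "trace (mat_power (A ** B) n) = trace (mat_power (B ** A) n)"
proof (cases n)
  case (Suc m)
  have "mat_power (B ** A) (Suc m) = B ** (A ** mat_power (B ** A) m)"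
    by (simp add: matrix_mul_assoc)
  then show ?thesis
    unfolding Suc mat_power_mult_Suc by (metis trace_mul_sym)
qed simp

lemma trace_mat_power_Suc_Suc:
  fixes A :: "'a::comm_ring_1^2^2"
  shows "trace (mat_power A (Suc (Suc n))) =
    trace A * trace (mat_power A (Suc n)) - det A * trace (mat_power A n)"
  by (simp add: trace_def matrix_matrix_mult_def sum_2 det_2 algebra_simps)

text \<open>Coefficients of \<open>z\<^sup>k\<close> in the first column of the \<open>n\<close>-th power of the matrix with the rows
  \<open>(z, s z)\<close> and \<open>(s / z, 1 / z)\<close>.\<close>

fun diag_coeff :: "real \<Rightarrow> nat \<Rightarrow> int \<Rightarrow> real"
  and offdiag_coeff :: "real \<Rightarrow> nat \<Rightarrow> int \<Rightarrow> real" where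
  "diag_coeff s 0 k = (if k = 0 then 1 else 0)"
| "diag_coeff s (Suc n) k = diag_coeff s n (k - 1) + s * offdiag_coeff s n (k - 1)"
| "offdiag_coeff s 0 k = 0"
| "offdiag_coeff s (Suc n) k = s * diag_coeff s n (k + 1) + offdiag_coeff s n (k + 1)"

text \<open>Expand a power as a sum over paths of coordinates: leaving the first one contributes
  \<open>z\<close>, leaving the second \<open>1 / z\<close>. A nonempty path from the second has a
  factor \<open>1 / z\<close>, hence the bound \<open>int n - 2\<close>.\<close>

lemma coeff_outside:
  "(k < - int n \<or> int n < k \<longrightarrow> diag_coeff s n k = 0) \<and>
   (k < - int n \<or> int n - 2 < k \<longrightarrow> offdiag_coeff s n k = 0)"
  by (induction n arbitrary: k) auto

lemma diag_coeff_bottom: "n \<noteq> 0 \<Longrightarrow> diag_coeff s n (- int n) = 0"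
  using coeff_outside by (cases n) auto

text \<open>Only the path that never leaves the first coordinate reaches this exponent, with weight
  1.\<close>

lemma diag_coeff_top: "diag_coeff s n (int n) = 1"
  using coeff_outside by (induction n) auto

lemma coeff_parity:
  "odd (k + int n) \<Longrightarrow> diag_coeff s n k = 0 \<and> offdiag_coeff s n k = 0"
  by (induction n arbitrary: k) auto

lemma coeff_nonneg:
  assumes "0 \<le> s"
  shows "0 \<le> diag_coeff s n k \<and> 0 \<le> offdiag_coeff s n k"
  using assms by (induction n arbitrary: k) auto

text \<open>All terms being nonnegative, one positive summand suffices. It comes from
  \<open>offdiag_coeff\<close> at the previous power, except at the upper end, where
  \<open>diag_coeff_top\<close> supplies it.\<close>

lemma coeff_pos:
  assumes "0 < s" "even (k + int n)"
  shows "(2 - int n \<le> k \<and> k \<le> int n \<longrightarrow> 0 < diag_coeff s n k) \<and>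
         (- int n \<le> k \<and> k \<le> int n - 2 \<longrightarrow> 0 < offdiag_coeff s n k)"
  using assms(2)
proof (induction n arbitrary: k)
  case (Suc n)
  have nonneg: "0 \<le> diag_coeff s n j" "0 \<le> offdiag_coeff s n j" for j
    using coeff_nonneg assms(1) by auto
  have "0 < diag_coeff s (Suc n) k" if k: "2 - int (Suc n) \<le> k" "k \<le> int (Suc n)"
  proof (cases "k = int (Suc n)")
    case True
    then show ?thesis using diag_coeff_top[of s "Suc n"] by simp
  next
    case False
    \<comment> \<open>Parity excludes \<open>k = int n\<close>, so below the top
      \<open>k - 1\<close> obeys the sharper bound for \<open>offdiag_coeff\<close>.\<close>
    have "even (k - 1 + int n)" "k \<noteq> int n" using Suc.prems by presburger+
    moreover from this have "k - 1 \<le> int n - 2" using k False by auto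
    ultimately have "0 < offdiag_coeff s n (k - 1)" using Suc.IH k by auto
    then show ?thesis using assms(1) nonneg by (simp add: add_nonneg_pos)
  qed
  moreover have "0 < offdiag_coeff s (Suc n) k" if k: "- int (Suc n) \<le> k" "k \<le> int (Suc n) - 2"
  proof (cases "k + 1 = int n")
    case True
    then show ?thesis using assms(1) nonneg by (simp add: diag_coeff_top add_pos_nonneg)
  next
    case False
    have "even (k + 1 + int n)" "k + 2 \<noteq> int n" using Suc.prems by presburger+
    moreover from this have "k + 1 \<le> int n - 2" using k False by auto
    ultimately have "0 < offdiag_coeff s n (k + 1)" using Suc.IH k by auto
    then show ?thesis using assms(1) nonneg by (simp add: add_nonneg_pos)
  qed
  ultimately show ?case by blast
qed auto

section \<open>Evaluation of Laurent polynomials on a symmetric window of exponents\<close>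

definition laurent_eval :: "(int \<Rightarrow> real) \<Rightarrow> nat \<Rightarrow> complex \<Rightarrow> complex" where
  "laurent_eval f n z = (\<Sum>k\<in>{- int n..int n}. of_real (f k) * z powi k)"

lemma laurent_eval_add:
  "laurent_eval (\<lambda>k. f k + g k) n z = laurent_eval f n z + laurent_eval g n z"
  by (simp add: laurent_eval_def sum.distrib algebra_simps)

lemma laurent_eval_mult:
  "laurent_eval (\<lambda>k. s * f k) n z = of_real s * laurent_eval f n z"
  by (simp add: laurent_eval_def sum_distrib_left mult.assoc)

lemma laurent_eval_inverse: "laurent_eval f n (inverse z) = laurent_eval (\<lambda>k. f (- k)) n z"
  unfolding laurent_eval_def
  by (rule sum.reindex_bij_witness[of _ uminus uminus])
    (auto simp: power_int_minus power_int_inverse)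

lemma laurent_eval_shift_up:
  assumes "z \<noteq> 0" "\<And>k. k < - int n \<or> int n < k \<Longrightarrow> f k = 0"
  shows "laurent_eval (\<lambda>k. f (k - 1)) (Suc n) z = z * laurent_eval f n z"
proof -
  \<comment> \<open>The exponents dropped are \<open>- int n - 1\<close> and \<open>- int n\<close>,
    where \<open>f (k - 1)\<close> vanishes by assumption.\<close>
  have "laurent_eval (\<lambda>k. f (k - 1)) (Suc n) z =
      (\<Sum>k\<in>{1 - int n..int n + 1}. of_real (f (k - 1)) * z powi k)"
    unfolding laurent_eval_def using assms(2) by (intro sum.mono_neutral_right) auto
  also have "\<dots> = (\<Sum>k\<in>{- int n..int n}. z * (of_real (f k) * z powi k))"
    by (rule sum.reindex_bij_witness[of _ "\<lambda>k. k + 1" "\<lambda>k. k - 1"])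
      (use assms(1) in \<open>auto simp: power_int_diff\<close>)
  finally show ?thesis by (simp add: laurent_eval_def sum_distrib_left)
qed

text \<open>Reflecting \<open>k\<close> to \<open>- k\<close> and \<open>z\<close> to
  \<open>inverse z\<close> reduces this to the upward shift.\<close>

lemma laurent_eval_shift_down:
  assumes "z \<noteq> 0" "\<And>k. k < - int n \<or> int n < k \<Longrightarrow> f k = 0"
  shows "laurent_eval (\<lambda>k. f (k + 1)) (Suc n) z = inverse z * laurent_eval f n z"
proof -
  have "laurent_eval (\<lambda>k. f (k + 1)) (Suc n) z =
      laurent_eval (\<lambda>k. f (- (k - 1))) (Suc n) (inverse z)"
    by (simp add: laurent_eval_inverse add.commute)
  also have "\<dots> = inverse z * laurent_eval (\<lambda>k. f (- k)) n (inverse z)"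
    using assms by (intro laurent_eval_shift_up) auto
  finally show ?thesis by (simp add: laurent_eval_inverse)
qed

lemma laurent_eval_diag_coeff_Suc:
  assumes "z \<noteq> 0"
  shows "laurent_eval (diag_coeff s (Suc n)) (Suc n) z =
    z * laurent_eval (diag_coeff s n) n z + of_real s * z * laurent_eval (offdiag_coeff s n) n z"
proof -
  have "diag_coeff s (Suc n) = (\<lambda>k. diag_coeff s n (k - 1) + s * offdiag_coeff s n (k - 1))"
    by auto
  moreover have "diag_coeff s n k = 0" "offdiag_coeff s n k = 0" if "k < - int n \<or> int n < k" for k
    using that coeff_outside[of k n s] by auto
  ultimately show ?thesis
    using laurent_eval_shift_up[OF assms, of n "diag_coeff s n"]
      laurent_eval_shift_up[OF assms, of n "offdiag_coeff s n"]
    by (simp add: laurent_eval_add laurent_eval_mult)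
qed

lemma laurent_eval_offdiag_coeff_Suc:
  assumes "z \<noteq> 0"
  shows "laurent_eval (offdiag_coeff s (Suc n)) (Suc n) z =
    of_real s * inverse z * laurent_eval (diag_coeff s n) n z +
    inverse z * laurent_eval (offdiag_coeff s n) n z"
proof -
  have "offdiag_coeff s (Suc n) = (\<lambda>k. s * diag_coeff s n (k + 1) + offdiag_coeff s n (k + 1))"
    by auto
  moreover have "diag_coeff s n k = 0" "offdiag_coeff s n k = 0" if "k < - int n \<or> int n < k" for k
    using that coeff_outside[of k n s] by auto
  ultimately show ?thesis
    using laurent_eval_shift_down[OF assms, of n "diag_coeff s n"]
      laurent_eval_shift_down[OF assms, of n "offdiag_coeff s n"]
    by (simp add: laurent_eval_add laurent_eval_mult)
qed

section \<open>The matrix \<open>D F\<^sup>2\<close> and the Laurent form of its traces\<close>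

definition M_mat :: "real \<Rightarrow> complex \<Rightarrow> complex^2^2" where
  "M_mat s z = vector [vector [z, of_real s * z], vector [of_real s * inverse z, inverse z]]"

lemma M_mat_nth:
  "M_mat s z $ 1 $ 1 = z" "M_mat s z $ 1 $ 2 = of_real s * z"
  "M_mat s z $ 2 $ 1 = of_real s * inverse z" "M_mat s z $ 2 $ 2 = inverse z"
  by (simp_all add: M_mat_def)

text \<open>Exchanging the coordinates turns \<open>M_mat s z\<close> into
  \<open>M_mat s (inverse z)\<close>, so the second column is the first, reversed, at
  \<open>inverse z\<close>.\<close>

lemma mat_power_M_mat:
  assumes "z \<noteq> 0"
  shows "mat_power (M_mat s z) n $ 1 $ 1 = laurent_eval (diag_coeff s n) n z \<and>
    mat_power (M_mat s z) n $ 2 $ 1 = laurent_eval (offdiag_coeff s n) n z \<and>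
    mat_power (M_mat s z) n $ 2 $ 2 = laurent_eval (diag_coeff s n) n (inverse z) \<and>
    mat_power (M_mat s z) n $ 1 $ 2 = laurent_eval (offdiag_coeff s n) n (inverse z)"
proof (induction n)
  case 0
  show ?case by (simp add: mat_def laurent_eval_def)
next
  case (Suc n)
  have "inverse z \<noteq> 0" using assms by simp
  then show ?case
    using Suc
    by (simp add: matrix_matrix_mult_def sum_2 M_mat_nth laurent_eval_diag_coeff_Suc
        laurent_eval_offdiag_coeff_Suc assms del: diag_coeff.simps offdiag_coeff.simps)
qed

text \<open>\<open>F_mat \<theta> ** F_mat \<theta>\<close> has ones on the diagonal and
  \<open>sin (2 * \<theta>)\<close> off it.\<close>

lemma M_mat_eq:
  "vector [vector [z, 0], vector [0, inverse z]] ** F_mat \<theta> ** F_mat \<theta> = M_mat (sin (2 * \<theta>)) z"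
proof -
  have "complex_of_real (cos \<theta>) ^ 2 + of_real (sin \<theta>) ^ 2 = 1"
    by (metis of_real_1 of_real_add of_real_power sin_cos_squared_add2 power2_eq_square)
  \<comment> \<open>\<open>w\<close> stands for \<open>z\<close> and \<open>inverse z\<close>; the
    two orders of summands are those of the two diagonal entries.\<close>
  then have "w * of_real (cos \<theta>) * of_real (cos \<theta>) + w * of_real (sin \<theta>) * of_real (sin \<theta>) = w"
    "w * of_real (sin \<theta>) * of_real (sin \<theta>) + w * of_real (cos \<theta>) * of_real (cos \<theta>) = w"
    for w :: complex
    by (algebra, algebra)
  then show ?thesis
    by (simp add: F_mat_def M_mat_def vec_eq_iff forall_2 matrix_matrix_mult_def sum_2 sin_double)
qed

lemma L_tr_eq_trace_M_mat: "L_tr n z (F_mat \<theta>) = trace (mat_power (M_mat (sin (2 * \<theta>)) z) n)"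
proof -
  let ?D = "vector [vector [z, 0], vector [0, inverse z]] :: complex^2^2"
  have "L_tr n z (F_mat \<theta>) = trace (mat_power (F_mat \<theta> ** (?D ** F_mat \<theta>)) n)"
    by (simp add: L_tr_def S_mat_def matrix_mul_assoc)
  then show ?thesis
    by (simp only: trace_mat_power_mult_commute[of "F_mat \<theta>"] M_mat_eq)
qed

text \<open>The second diagonal entry is the first at \<open>inverse z\<close>, hence the reflected
  coefficient; symmetry in \<open>k\<close> is built in.\<close>

definition trace_coeff :: "real \<Rightarrow> nat \<Rightarrow> int \<Rightarrow> real" where
  "trace_coeff s n k = diag_coeff s n k + diag_coeff s n (- k)"

lemma trace_mat_power_M_mat:
  assumes "z \<noteq> 0"
  shows "trace (mat_power (M_mat s z) n) = laurent_eval (trace_coeff s n) n z"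
  using mat_power_M_mat[OF assms, of s n]
  by (simp add: trace_def sum_2 laurent_eval_inverse trace_coeff_def[abs_def] laurent_eval_add)

lemma laurent_eval_split_ends:
  assumes "n \<noteq> 0"
  shows "laurent_eval f n z = of_real (f (int n)) * z powi int n +
    of_real (f (- int n)) * z powi (- int n) +
    (\<Sum>k\<in>{- (int n - 1)..int n - 1}. of_real (f k) * z powi k)"
proof -
  have "{- int n..int n} = insert (int n) (insert (- int n) {- (int n - 1)..int n - 1})"
    using assms by auto
  then show ?thesis using assms by (simp add: laurent_eval_def)
qed

lemma L_tr_Laurent:
  assumes "z \<noteq> 0" "n \<noteq> 0"
  shows "L_tr n z (F_mat \<theta>) = z powi int n + z powi (- int n) +
    (\<Sum>k\<in>{- (int n - 1)..int n - 1}. of_real (trace_coeff (sin (2 * \<theta>)) n k) * z powi k)"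
proof -
  \<comment> \<open>\<open>diag_coeff\<close> is 1 at the top and, as \<open>n \<noteq> 0\<close>, 0
    at the bottom, so each end receives a single 1.\<close>
  have "trace_coeff (sin (2 * \<theta>)) n (int n) = 1" "trace_coeff (sin (2 * \<theta>)) n (- int n) = 1"
    using assms(2) by (simp_all add: trace_coeff_def diag_coeff_top diag_coeff_bottom)
  then show ?thesis
    unfolding L_tr_eq_trace_M_mat trace_mat_power_M_mat[OF assms(1)]
      laurent_eval_split_ends[OF assms(2)] by simp
qed

lemma trace_coeff_parity: "odd (k + int n) \<Longrightarrow> trace_coeff s n k = 0"
  using coeff_parity[of k n s] coeff_parity[of "- k" n s] by (simp add: trace_coeff_def)

lemma trace_coeff_pos:
  assumes "0 < s" "even (k + int n)" "- (int n - 1) \<le> k" "k \<le> int n - 1"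
  shows "0 < trace_coeff s n k"
proof -
  \<comment> \<open>Parity excludes the one exponent in range below the bound
    \<open>2 - int n\<close> of \<open>coeff_pos\<close>.\<close>
  have "k \<noteq> 1 - int n" using assms(2) by presburger
  then have "0 < diag_coeff s n k" using coeff_pos[OF assms(1,2)] assms(3,4) by auto
  then show ?thesis
    using coeff_nonneg[of s n "- k"] assms(1) by (simp add: trace_coeff_def)
qed

section \<open>The Chebyshev form\<close>

lemma det_M_mat:
  assumes "z \<noteq> 0"
  shows "det (M_mat (sin t) z) = of_real (cos t) ^ 2"
proof -
  have "det (M_mat (sin t) z) = 1 - of_real (sin t) ^ 2"
    using assms by (simp add: det_2 M_mat_nth power2_eq_square)
  also have "\<dots> = of_real (1 - sin t ^ 2)" by simp
  also have "\<dots> = of_real (cos t ^ 2)" by (simp only: cos_squared_eq)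
  finally show ?thesis by simp
qed

text \<open>The eigenvalues of \<open>A\<close> are \<open>c\<close> times the exponentials of
  \<open>i a\<close> and \<open>- i a\<close>. Cosines of multiples of \<open>a\<close> satisfy the
  matching recurrence, so induction avoids diagonalization.\<close>

lemma trace_mat_power_cos:
  fixes A :: "complex^2^2"
  assumes "trace A = 2 * c * cos a" "det A = c ^ 2"
  shows "trace (mat_power A n) = 2 * c ^ n * cos (of_nat n * a)"
proof (induction n rule: induct_nat_012)
  case 0
  show ?case by (simp add: trace_def mat_def sum_2)
next
  case 1
  show ?case using assms(1) by simp
next
  case (ge2 n)
  have "cos (of_nat (Suc (Suc n)) * a) + cos (of_nat n * a) = 2 * cos a * cos (of_nat (Suc n) * a)"
    using cos_add[of "of_nat (Suc n) * a" a] cos_diff[of "of_nat (Suc n) * a" a]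
    by (simp add: algebra_simps)
  then have rec: "cos (of_nat (Suc (Suc n)) * a) =
      2 * cos a * cos (of_nat (Suc n) * a) - cos (of_nat n * a)"
    by (simp add: algebra_simps)
  show ?case
    unfolding trace_mat_power_Suc_Suc ge2 assms rec
    by (simp add: algebra_simps power2_eq_square del: of_nat_Suc)
qed

lemma L_tr_Chebyshev:
  assumes "z \<noteq> 0" "cos (2 * \<theta>) \<noteq> 0"
  shows "L_tr n z (F_mat \<theta>) = 2 * of_real (cos (2 * \<theta>)) ^ n *
    poly (Chebyshev_T n) ((z + inverse z) / (2 * of_real (cos (2 * \<theta>))))"
proof -
  let ?c = "complex_of_real (cos (2 * \<theta>))"
  have "?c \<noteq> 0" using assms(2) by (simp only: of_real_eq_0_iff not_False_eq_True)
  \<comment> \<open>Since \<open>cos (Arccos w) = w\<close> for every complex \<open>w\<close>, this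
    \<open>Arccos\<close> serves as the angle \<open>a\<close> for all nonzero
    \<open>z\<close>.\<close>
  then have "trace (M_mat (sin (2 * \<theta>)) z) = 2 * ?c * cos (Arccos ((z + inverse z) / (2 * ?c)))"
    by (simp add: trace_def sum_2 M_mat_nth)
  then show ?thesis
    unfolding L_tr_eq_trace_M_mat poly_Chebyshev_T
    by (rule trace_mat_power_cos) (rule det_M_mat[OF assms(1)])
qed

theorem theorem2p1:
  shows "\<exists>p :: int \<Rightarrow> nat \<Rightarrow> real \<Rightarrow> real.
    \<forall>(\<theta>::real) \<in> {0..pi/4}. \<forall>n::nat. n \<ge> 1 \<longrightarrow>
      (\<forall>z::complex. z \<noteq> 0 \<longrightarrow>
         L_tr n z (F_mat \<theta>) =
           z powi (int n) + z powi (- int n)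
             + (\<Sum>k\<in>{- (int n - 1)..int n - 1}. of_real (p k n \<theta>) * z powi k)) \<and>
      (\<forall>k\<in>{- (int n - 1)..int n - 1}. p k n \<theta> = p (- k) n \<theta>) \<and>
      (\<theta> \<in> {0<..<pi/4} \<longrightarrow>
         (\<forall>k\<in>{- (int n - 1)..int n - 1}.
            (\<not> [k = int n] (mod 2) \<longrightarrow> p k n \<theta> = 0) \<and>
            ([k = int n] (mod 2) \<longrightarrow> p k n \<theta> > 0))) \<and>
      (\<theta> \<in> {0..<pi/4} \<longrightarrow>
         (\<forall>z::complex. z \<noteq> 0 \<longrightarrow>
            L_tr n z (F_mat \<theta>) =
              2 * of_real (cos (2 * \<theta>)) ^ n *
                poly (Chebyshev_T n) ((z + inverse z) / (2 * of_real (cos (2 * \<theta>))))))"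
proof (intro exI[of _ "\<lambda>k n \<theta>. trace_coeff (sin (2 * \<theta>)) n k"] ballI allI impI conjI)
  fix \<theta> :: real and n :: nat and k :: int
  assume \<theta>: "\<theta> \<in> {0<..<pi/4}" and k: "k \<in> {- (int n - 1)..int n - 1}"
  have parity: "[k = int n] (mod 2) \<longleftrightarrow> even (k + int n)"
    by (simp add: cong_def) presburger
  show "trace_coeff (sin (2 * \<theta>)) n k = 0" if "\<not> [k = int n] (mod 2)"
    using that parity by (simp add: trace_coeff_parity)
  have "0 < sin (2 * \<theta>)" using \<theta> by (intro sin_gt_zero) auto
  then show "0 < trace_coeff (sin (2 * \<theta>)) n k" if "[k = int n] (mod 2)"
    using that parity k by (simp add: trace_coeff_pos)
next
  fix \<theta> :: real and n :: nat and z :: complex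
  assume "\<theta> \<in> {0..<pi/4}" and z: "z \<noteq> 0"
  \<comment> \<open>\<open>2 * \<theta>\<close> stays strictly below \<open>pi / 2\<close>, so
    dividing by the cosine is legitimate.\<close>
  then have "0 < cos (2 * \<theta>)" by (intro cos_gt_zero_pi) auto
  then show "L_tr n z (F_mat \<theta>) = 2 * of_real (cos (2 * \<theta>)) ^ n *
      poly (Chebyshev_T n) ((z + inverse z) / (2 * of_real (cos (2 * \<theta>))))"
    using L_tr_Chebyshev z by simp
qed (simp_all add: L_tr_Laurent trace_coeff_def)

end
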